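(* Let $0\leqslant\alpha<1$, $0\leqslant\lambda<1$, $\beta>0$ and let $n\geqslant 1$ be an integer. Let $\mathcal{F}_{\alpha,\beta,n}$ be the family of all functions $F(z)=f(z)(Q(z))^{\beta/n}$ on $\mathbb{D}$, where $f\in\mathcal{ST}(\alpha)$ and $Q$ is a polynomial of degree $n$ with $Q(0)=1$ and all zeros in $\mathbb{C}\setminus\mathbb{D}$. Then the radius of starlikeness of order $\lambda$ of this family, that is, the largest $R\in(0,1)$ such that $z\mapsto r^{-1}F(rz)$ belongs to $\mathcal{ST}(\lambda)$ for all $F\in\mathcal{F}_{\alpha,\beta,n}$ and all $0<r<R$, is \[R_{\mathcal{ST}(\lambda)}(F)=\dfrac{2(1-\lambda)}{2-2\alpha+\beta+\sqrt{(2-2\alpha+\beta)^2+4(1-\lambda)(2\alpha+\beta-1-\lambda)}}.\]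
   Context: $\mathbb{D}=\{z\in\mathbb{C}:|z|<1\}$. $\mathcal{A}$ is the class of analytic functions $f$ on $\mathbb{D}$ with $f(0)=0$, $f'(0)=1$. For $0\leqslant\alpha<1$, $\mathcal{ST}(\alpha)$ (starlike functions of order $\alpha$) is the class of $f\in\mathcal{A}$ with $\operatorname{Re}(zf'(z)/f(z))>\alpha$ for all $z\in\mathbb{D}$ (the quotient being given the value $1$ at $z=0$). Since $Q$ is non-vanishing in $\mathbb{D}$ and $Q(0)=1$, $(Q(z))^{\beta/n}$ denotes the analytic branch on $\mathbb{D}$ equal to $1$ at $z=0$, so $F\in\mathcal{A}$. *)

theory Defs
  imports "HOL-Complex_Analysis.Complex_Analysis" "HOL-Computational_Algebra.Polynomial"
begin

abbreviation unit_disc :: "complex set" where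
  "unit_disc \<equiv> ball 0 1"

text \<open>
  Functions on the unit disc are total functions on the complex plane of which only the values
  on \<^term>\<open>unit_disc\<close> matter.
\<close>

definition normalized_analytic :: "(complex \<Rightarrow> complex) set" where
  "normalized_analytic = {f. f holomorphic_on unit_disc \<and> f 0 = 0 \<and> deriv f 0 = 1}"

definition starlike_quotient :: "(complex \<Rightarrow> complex) \<Rightarrow> complex \<Rightarrow> complex" where
  "starlike_quotient f z = (if z = 0 then 1 else z * deriv f z / f z)"

text \<open>
  The quotient has to be defined on the whole disc. Since division by zero is total here, the
  absence of zeros of \<open>f\<close> other than \<open>0\<close> is spelled out (for \<open>\<alpha> \<ge> 0\<close> it also follows
  from the inequality).
\<close>

definition starlike_of_order :: "real \<Rightarrow> (complex \<Rightarrow> complex) set" where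
  "starlike_of_order \<alpha> =
     {f \<in> normalized_analytic.
        (\<forall>z\<in>unit_disc. z \<noteq> 0 \<longrightarrow> f z \<noteq> 0) \<and>
        (\<forall>z\<in>unit_disc. Re (starlike_quotient f z) > \<alpha>)}"

text \<open>
  \<open>g\<close> is the analytic branch of \<open>q\<^sup>a\<close> on the disc with \<open>g 0 = 1\<close>, where a branch of the power
  is \<open>exp (a L)\<close> for an analytic logarithm \<open>L\<close> of \<open>q\<close>. For non-vanishing \<open>q\<close> with
  \<open>q 0 = 1\<close> it exists and is unique on the disc. The principal power \<open>q z powr a\<close> would not do,
  as the values of \<open>q\<close> may wind around \<open>0\<close>.
\<close>

definition is_power_branch ::
    "(complex \<Rightarrow> complex) \<Rightarrow> real \<Rightarrow> (complex \<Rightarrow> complex) \<Rightarrow> bool" where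
  "is_power_branch q a g \<longleftrightarrow>
     (\<exists>L. L holomorphic_on unit_disc \<and>
          (\<forall>z\<in>unit_disc. exp (L z) = q z) \<and>
          (\<forall>z\<in>unit_disc. g z = exp (complex_of_real a * L z))) \<and>
     g 0 = 1"

definition starlike_poly_family :: "real \<Rightarrow> real \<Rightarrow> nat \<Rightarrow> (complex \<Rightarrow> complex) set" where
  "starlike_poly_family \<alpha> \<beta> n =
     {F. \<exists>f (Q :: complex poly) g.
           f \<in> starlike_of_order \<alpha> \<and>
           degree Q = n \<and> poly Q 0 = 1 \<and> (\<forall>z. poly Q z = 0 \<longrightarrow> z \<notin> unit_disc) \<and>
           is_power_branch (poly Q) (\<beta> / real n) g \<and>
           (\<forall>z\<in>unit_disc. F z = f z * g z)}"

definition starlike_radii :: "real \<Rightarrow> (complex \<Rightarrow> complex) set \<Rightarrow> real set" where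
  "starlike_radii \<mu> \<F> =
     {R. 0 < R \<and> R < 1 \<and>
         (\<forall>F\<in>\<F>. \<forall>r. 0 < r \<and> r < R \<longrightarrow>
            (\<lambda>z. F (complex_of_real r * z) / complex_of_real r) \<in> starlike_of_order \<mu>)}"

definition is_radius_of_starlikeness :: "real \<Rightarrow> (complex \<Rightarrow> complex) set \<Rightarrow> real \<Rightarrow> bool" where
  "is_radius_of_starlikeness \<mu> \<F> R \<longleftrightarrow>
     R \<in> starlike_radii \<mu> \<F> \<and> (\<forall>R'\<in>starlike_radii \<mu> \<F>. R' \<le> R)"

end

theory Submission
  imports Defs "HOL-Computational_Algebra.Fundamental_Theorem_Algebra"
begin

text \<open>
  For \<open>F = f Q\<^bsup>\<beta>/n\<^esup>\<close> one has \<open>z F'/F = z f'/f + (\<beta>/n) z Q'/Q\<close>. On \<open>\<bar>z\<bar> = r\<close> the Schwarz lemma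
  gives \<open>Re (z f'/f) \<ge> \<alpha> + (1 - \<alpha>)(1 - r)/(1 + r)\<close>, and each zero of \<open>Q\<close> contributes at least
  \<open>- r/(1 - r)\<close> to \<open>Re (z Q'/Q)\<close>. The sum of the two bounds exceeds \<open>\<mu>\<close> exactly for \<open>r\<close> below the
  smallest positive root of \<open>(1 - \<mu>) - (2 - 2\<alpha> + \<beta>) r - (2\<alpha> + \<beta> - 1 - \<mu>) r\<^sup>2\<close>. Both bounds are
  attained at the point \<open>z = r\<close> by \<open>f z = z (1 + z)\<^bsup>2\<alpha> - 2\<^esup>\<close> and \<open>Q z = (1 - z)\<^sup>n\<close>.
\<close>

section \<open>Real-part bounds from the Schwarz lemma\<close>

text \<open>For \<open>r > 0\<close> the hypothesis describes a closed disc whose diameter on the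
  real axis runs from \<open>(1 - r) / (1 + r)\<close> to \<open>(1 + r) / (1 - r)\<close>; the
  bound is its leftmost point.\<close>

lemma Re_ge_of_Cayley:
  fixes q :: complex
  assumes "0 \<le> r" "r < 1" and le: "norm (q - 1) \<le> r * norm (q + 1)"
  shows "Re q \<ge> (1 - r) / (1 + r)"
proof (rule ccontr)
  define x y where "x = Re q" and "y = Im q"
  assume "\<not> Re q \<ge> (1 - r) / (1 + r)"
  then have a: "(1 + r) * x < 1 - r"
    using assms by (simp add: x_def field_simps)
  \<comment> \<open>\<open>x\<close> also lies to the left of the other end of the diameter, so both
    linear factors in the identity below are positive.\<close>
  have b: "(1 - r) * x < 1 + r"
  proof (cases "x \<le> 0")
    case True
    then have "(1 - r) * x \<le> 0" using assms by (simp add: mult_nonneg_nonpos)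
    then show ?thesis using assms by linarith
  next
    case False
    then have "(1 - r) * x \<le> (1 + r) * x" using assms by (intro mult_right_mono) auto
    then show ?thesis using a assms by linarith
  qed
  have "(norm (q - 1))\<^sup>2 \<le> r\<^sup>2 * (norm (q + 1))\<^sup>2"
    using power_mono[OF le, of 2] by (simp add: power_mult_distrib)
  then have "(x - 1)\<^sup>2 + y\<^sup>2 \<le> r\<^sup>2 * ((x + 1)\<^sup>2 + y\<^sup>2)"
    by (simp add: cmod_power2 x_def y_def)
  moreover have "(x - 1)\<^sup>2 + y\<^sup>2 - r\<^sup>2 * ((x + 1)\<^sup>2 + y\<^sup>2)
      = (1 - r - (1 + r) * x) * (1 + r - (1 - r) * x) + (1 - r\<^sup>2) * y\<^sup>2"
    by (simp add: power2_eq_square algebra_simps)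
  moreover have "(1 - r - (1 + r) * x) * (1 + r - (1 - r) * x) > 0"
    using a b by (intro mult_pos_pos) auto
  moreover have "(1 - r\<^sup>2) * y\<^sup>2 \<ge> 0"
    using assms by (simp add: abs_square_le_1 power_le_one)
  ultimately show False by linarith
qed

text \<open>The Cayley transform \<open>w\<close> of \<open>q\<close> maps the disc into itself and
  fixes 0, so the Schwarz lemma bounds \<open>norm (w z)\<close> by \<open>norm z\<close>; the
  previous lemma translates this back to \<open>q\<close>.\<close>

lemma Re_ge_of_Re_pos:
  assumes holo: "q holomorphic_on unit_disc" and q0: "q 0 = 1"
    and pos: "\<And>z. z \<in> unit_disc \<Longrightarrow> Re (q z) > 0"
    and z: "z \<in> unit_disc"
  shows "Re (q z) \<ge> (1 - norm z) / (1 + norm z)"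
proof -
  define w where "w = (\<lambda>z. (q z - 1) / (q z + 1))"
  have nz: "q z + 1 \<noteq> 0" if "z \<in> unit_disc" for z
    using pos[OF that] by (auto simp: complex_eq_iff)
  have "w holomorphic_on unit_disc"
    unfolding w_def using nz by (intro holomorphic_intros holo) auto
  moreover have "w 0 = 0"
    by (simp add: w_def q0)
  moreover have "norm (w z) < 1" if "norm z < 1" for z
  proof -
    \<comment> \<open>The two squares differ by \<open>4 * Re (q z)\<close>.\<close>
    have "(norm (q z - 1))\<^sup>2 < (norm (q z + 1))\<^sup>2"
      using pos[of z] that by (simp add: cmod_power2) (simp add: power2_eq_square algebra_simps)
    then have "norm (q z - 1) < norm (q z + 1)"
      by (rule power2_less_imp_less) simp
    then show ?thesis
      using nz[of z] that by (simp add: w_def norm_divide)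
  qed
  ultimately have "norm (w z) \<le> norm z"
    using Schwarz_Lemma(1)[of w z] z by simp
  then have "norm (q z - 1) \<le> norm z * norm (q z + 1)"
    using nz[OF z] by (simp add: w_def norm_divide divide_le_eq)
  then show ?thesis
    using z by (intro Re_ge_of_Cayley) auto
qed

text \<open>The singularity of \<open>f z / z\<close> at 0 is removable. Its extension
  \<open>h\<close> has no zeros in the disc and \<open>h 0 = 1\<close>, so
  \<open>deriv f z / h z\<close> is holomorphic and takes the conventional value 1 at 0.\<close>

lemma starlike_quotient_holomorphic:
  assumes "f \<in> normalized_analytic" and nz: "\<And>z. z \<in> unit_disc \<Longrightarrow> z \<noteq> 0 \<Longrightarrow> f z \<noteq> 0"
  shows "starlike_quotient f holomorphic_on unit_disc"
proof -
  have f: "f holomorphic_on unit_disc" "f 0 = 0" "deriv f 0 = 1"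
    using assms by (auto simp: normalized_analytic_def)
  define h where "h = (\<lambda>z. if z = 0 then deriv f 0 else (f z - f 0) / (z - 0))"
  have "h holomorphic_on unit_disc"
    unfolding h_def by (intro pole_lemma f) simp
  moreover have "h z \<noteq> 0" if "z \<in> unit_disc" for z
    using nz[OF that] f by (simp add: h_def)
  ultimately have "(\<lambda>z. deriv f z / h z) holomorphic_on unit_disc"
    by (intro holomorphic_intros holomorphic_deriv f) auto
  then show ?thesis
    by (rule holomorphic_transform) (simp add: starlike_quotient_def h_def f)
qed

text \<open>Subtracting \<alpha> and dividing by \<open>1 - \<alpha>\<close> yields a function
  \<open>q\<close> with positive real part and \<open>q 0 = 1\<close>.\<close>

lemma starlike_of_order_Re_ge:
  assumes f: "f \<in> starlike_of_order \<alpha>" and "\<alpha> < 1" and z: "z \<in> unit_disc"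
  shows "Re (starlike_quotient f z) \<ge> \<alpha> + (1 - \<alpha>) * ((1 - norm z) / (1 + norm z))"
proof -
  define q where "q = (\<lambda>z. (starlike_quotient f z - of_real \<alpha>) / of_real (1 - \<alpha>))"
  have Re_q: "Re (q z) = (Re (starlike_quotient f z) - \<alpha>) / (1 - \<alpha>)" for z
    unfolding q_def Re_divide_of_real by simp
  have "starlike_quotient f holomorphic_on unit_disc"
    using f by (intro starlike_quotient_holomorphic) (auto simp: starlike_of_order_def)
  then have "q holomorphic_on unit_disc"
    unfolding q_def using \<open>\<alpha> < 1\<close> by (intro holomorphic_intros) (auto simp del: of_real_diff)
  moreover have "q 0 = 1"
  proof -
    have "complex_of_real (1 - \<alpha>) \<noteq> 0"
      using \<open>\<alpha> < 1\<close> by (subst of_real_eq_0_iff) simp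
    then show ?thesis by (simp add: q_def starlike_quotient_def)
  qed
  moreover have "Re (q z) > 0" if "z \<in> unit_disc" for z
    using f that \<open>\<alpha> < 1\<close> by (auto simp: Re_q starlike_of_order_def)
  ultimately have "Re (q z) \<ge> (1 - norm z) / (1 + norm z)"
    using z by (intro Re_ge_of_Re_pos)
  then show ?thesis
    using \<open>\<alpha> < 1\<close> by (simp only: Re_q) (simp add: pos_le_divide_eq algebra_simps)
qed

section \<open>Logarithmic derivatives of polynomials without zeros in the disc\<close>

text \<open>The real part is at least minus the modulus, and \<open>norm (z - a)\<close> is at least
  \<open>1 - norm z\<close>.\<close>

lemma Re_linear_factor_ge:
  fixes z a :: complex
  assumes "norm z < 1" "norm a \<ge> 1"
  shows "Re (z / (z - a)) \<ge> - (norm z / (1 - norm z))"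
proof -
  have "norm a - norm z \<le> norm (z - a)"
    by (metis norm_minus_commute norm_triangle_ineq2)
  moreover have "norm z - norm z * norm z \<le> norm a * norm z - norm z * norm z"
    using mult_right_mono[OF assms(2), of "norm z"] by simp
  ultimately have *: "norm a - norm z > 0" "norm (z - a) > 0" "norm (z - a) \<ge> norm a - norm z"
    using assms by auto
  have "norm z / norm (z - a) \<le> norm z / (1 - norm z)"
    using assms * by (intro divide_left_mono mult_pos_pos) auto
  moreover have "- Re (z / (z - a)) \<le> norm (z / (z - a))"
    using abs_Re_le_cmod[of "z / (z - a)"] by linarith
  ultimately show ?thesis
    by (simp add: norm_divide)
qed

text \<open>The expression is the sum of \<open>z / (z - a)\<close> over the zeros \<open>a\<close>
  with multiplicity. The induction splits off one zero at a time, supplied by the fundamental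
  theorem of algebra.\<close>

lemma poly_log_deriv_Re_ge:
  fixes Q :: "complex poly"
  assumes "\<And>z. poly Q z = 0 \<Longrightarrow> norm z \<ge> 1" and z: "norm z < 1"
  shows "Re (z * poly (pderiv Q) z / poly Q z) \<ge> - (real (degree Q) * (norm z / (1 - norm z)))"
  using assms(1)
proof (induction "degree Q" arbitrary: Q)
  case 0
  then obtain c where "Q = [:c:]" by (metis degree_eq_zeroE)
  then show ?case by simp
next
  case (Suc m)
  obtain a where a: "poly Q a = 0"
    using fundamental_theorem_of_algebra[of Q] Suc.hyps(2) by (auto simp: constant_degree)
  then obtain P where Q: "Q = [:-a, 1:] * P"
    by (auto simp: poly_eq_0_iff_dvd dvd_def)
  have P0: "P \<noteq> 0" using Suc.hyps(2) Q by auto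
  then have "degree Q = Suc (degree P)"
    unfolding Q by (subst degree_mult_eq) auto
  then have m: "m = degree P" using Suc.hyps(2) by simp
  have roots: "norm w \<ge> 1" if "poly P w = 0" for w
    using Suc.prems[of w] that by (simp add: Q)
  have a1: "norm a \<ge> 1" using Suc.prems a by blast
  have nz: "z - a \<noteq> 0" "poly P z \<noteq> 0" using a1 z roots[of z] by auto
  have "z * poly (pderiv Q) z / poly Q z = z / (z - a) + z * poly (pderiv P) z / poly P z"
    using nz unfolding Q by (simp only: pderiv_mult) (simp add: pderiv_pCons field_simps)
  then show ?case
    using Suc.hyps(1)[OF m roots] Re_linear_factor_ge[OF z a1] m
    by (simp flip: Suc.hyps(2) add: algebra_simps add_divide_distrib)
qed

section \<open>The quadratic that determines the radius\<close>

text \<open>The quadratic is positive at 0 and, by \<open>a < b + c\<close>, negative at 1, so it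
  vanishes in between. Having the square root in the denominator lets one formula serve every sign
  of \<open>c\<close>, including \<open>c = 0\<close>, where it gives \<open>a / b\<close>.\<close>

lemma quadratic_smallest_root:
  fixes a b c :: real
  assumes "a > 0" "b > 0" "a < b + c"
  defines "R \<equiv> 2 * a / (b + sqrt (b\<^sup>2 + 4 * a * c))"
  shows "0 < R" "R < 1" "a - b * R - c * R\<^sup>2 = 0"
    and "\<And>r. 0 \<le> r \<Longrightarrow> r < R \<Longrightarrow> a - b * r - c * r\<^sup>2 > 0"
proof -
  define s where "s = sqrt (b\<^sup>2 + 4 * a * c)"
  have "a * (a - b) < a * c"
    using assms by (intro mult_strict_left_mono) auto
  then have D: "(2 * a - b)\<^sup>2 < b\<^sup>2 + 4 * a * c"
    by (simp add: power2_eq_square algebra_simps)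
  then have s2: "s\<^sup>2 = b\<^sup>2 + 4 * a * c"
    unfolding s_def by (intro real_sqrt_pow2) (smt (verit) zero_le_power2)
  \<comment> \<open>Both signs matter: \<open>s > 2 * a - b\<close> gives \<open>R < 1\<close>, and
    \<open>s > b - 2 * a\<close> makes the second factor below positive at 1.\<close>
  have s: "\<bar>2 * a - b\<bar> < s"
    unfolding s_def by (intro real_less_rsqrt) (use D in simp)
  have bs: "b + s > 0" "R = 2 * a / (b + s)"
    using s assms by (auto simp: R_def s_def)
  show "0 < R" "R < 1"
    using bs s assms by auto
  \<comment> \<open>Once \<open>c\<close> is expressed through \<open>s\<close>, the factorization
    is an algebraic identity. Its first factor vanishes at \<open>R = 1 / k\<close>, the second at
    the conjugate root if there is one.\<close>
  have c: "c = (s\<^sup>2 - b\<^sup>2) / (4 * a)"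
    using s2 assms by simp
  define k where "k = (b + s) / (2 * a)"
  have factor: "a - b * r - c * r\<^sup>2 = (1 - k * r) * (a + (s - b) / 2 * r)" for r
    unfolding c k_def using \<open>a > 0\<close> by (simp add: field_simps power2_eq_square)
  have kR: "k > 0" "k * R = 1"
    using bs \<open>a > 0\<close> by (auto simp: k_def)
  show "a - b * R - c * R\<^sup>2 = 0"
    by (simp only: factor kR) simp
  fix r assume r: "0 \<le> r" "r < R"
  have "k * r < k * R"
    using r kR(1) by (intro mult_strict_left_mono)
  then have "1 - k * r > 0"
    using kR(2) by simp
  moreover have "a + (s - b) / 2 * r > 0"
  proof -
    \<comment> \<open>An affine function of \<open>r\<close> is a convex combination of its values
      at 0 and 1, both positive here.\<close>
    have "a + (s - b) / 2 * r = (1 - r) * a + r * (a + (s - b) / 2)"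
      by (simp add: algebra_simps)
    moreover have "(1 - r) * a > 0"
      using r \<open>R < 1\<close> \<open>a > 0\<close> by simp
    moreover have "2 * a + s - b > 0"
      using s by linarith
    then have "a + (s - b) / 2 > 0"
      by (simp add: field_simps)
    then have "r * (a + (s - b) / 2) \<ge> 0"
      using r by simp
    ultimately show ?thesis by linarith
  qed
  ultimately show "a - b * r - c * r\<^sup>2 > 0"
    by (simp add: factor)
qed

text \<open>Reduces the comparison of the bound with \<mu> to the sign of the quadratic, since the
  denominator is positive.\<close>

lemma lower_bound_minus_order_eq:
  fixes r :: real
  assumes "0 \<le> r" "r < 1"
  shows "\<alpha> + (1 - \<alpha>) * ((1 - r) / (1 + r)) - \<beta> * (r / (1 - r)) - \<mu> =
    ((1 - \<mu>) - (2 - 2 * \<alpha> + \<beta>) * r - (2 * \<alpha> + \<beta> - 1 - \<mu>) * r\<^sup>2) / ((1 + r) * (1 - r))"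
proof -
  have "1 + r \<noteq> 0" "1 - r \<noteq> 0" using assms by auto
  then show ?thesis
    by (simp add: divide_simps) (simp add: power2_eq_square algebra_simps)
qed

section \<open>Products, power branches and dilations\<close>

lemma normalized_analytic_mult:
  assumes f: "f \<in> normalized_analytic" and g: "g holomorphic_on unit_disc" "g 0 = 1"
    and F: "\<And>z. z \<in> unit_disc \<Longrightarrow> F z = f z * g z"
  shows "F \<in> normalized_analytic"
proof -
  have f': "f holomorphic_on unit_disc" "f 0 = 0" "deriv f 0 = 1"
    using f by (auto simp: normalized_analytic_def)
  have "(f has_field_derivative 1) (at 0)"
    using holomorphic_derivI[OF f'(1), of 0] f' by simp
  moreover have "(g has_field_derivative deriv g 0) (at 0)"
    using holomorphic_derivI[OF g(1), of 0] by simp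
  ultimately have "((\<lambda>z. f z * g z) has_field_derivative 1) (at 0)"
    using DERIV_mult[of f 1 0 UNIV g "deriv g 0"] f' g by simp
  \<comment> \<open>\<open>F\<close> is known only on the disc, but this is an open set around 0, so
    the derivative carries over.\<close>
  then have "(F has_field_derivative 1) (at 0)"
    by (rule has_field_derivative_transform_within_open[of _ _ _ unit_disc]) (auto simp: F)
  moreover have "F holomorphic_on unit_disc"
    by (rule holomorphic_transform[of "\<lambda>z. f z * g z"]) (auto intro!: holomorphic_intros f' g simp: F)
  ultimately show ?thesis
    using F[of 0] f' by (auto simp: normalized_analytic_def intro: DERIV_imp_deriv)
qed

text \<open>Away from 0 this is additivity of the logarithmic derivative; at 0 both quotients have
  the conventional value 1 and the extra term vanishes.\<close>

lemma starlike_quotient_mult: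
  assumes "f holomorphic_on unit_disc" "g holomorphic_on unit_disc"
    and F: "\<And>z. z \<in> unit_disc \<Longrightarrow> F z = f z * g z"
    and z: "z \<in> unit_disc" "z \<noteq> 0 \<Longrightarrow> f z \<noteq> 0" "g z \<noteq> 0"
  shows "starlike_quotient F z = starlike_quotient f z + z * deriv g z / g z"
proof -
  have "(f has_field_derivative deriv f z) (at z)" "(g has_field_derivative deriv g z) (at z)"
    using assms by (auto intro!: holomorphic_derivI[of _ unit_disc])
  then have "((\<lambda>z. f z * g z) has_field_derivative deriv f z * g z + deriv g z * f z) (at z)"
    by (rule DERIV_mult)
  then have "(F has_field_derivative deriv f z * g z + deriv g z * f z) (at z)"
    by (rule has_field_derivative_transform_within_open[of _ _ _ unit_disc]) (use F z in auto)
  then have "deriv F z = deriv f z * g z + deriv g z * f z"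
    by (rule DERIV_imp_deriv)
  then show ?thesis
    using z F[OF z(1)] by (auto simp: starlike_quotient_def field_simps)
qed

text \<open>Differentiating \<open>exp (L z) = poly Q z\<close> gives \<open>L' = Q' / Q\<close>,
  and \<open>g = exp (a L)\<close> gives \<open>g' / g = a L'\<close>, so the logarithm itself drops
  out.\<close>

lemma is_power_branch_log_deriv:
  assumes "is_power_branch (poly Q) a g"
  shows "g holomorphic_on unit_disc" "g 0 = 1"
    and "\<And>z. z \<in> unit_disc \<Longrightarrow> g z \<noteq> 0"
    and "\<And>z. z \<in> unit_disc \<Longrightarrow>
      deriv g z / g z = complex_of_real a * (poly (pderiv Q) z / poly Q z)"
proof -
  obtain L where L: "L holomorphic_on unit_disc"
    and Q: "\<And>z. z \<in> unit_disc \<Longrightarrow> exp (L z) = poly Q z"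
    and g: "\<And>z. z \<in> unit_disc \<Longrightarrow> g z = exp (complex_of_real a * L z)"
    using assms by (auto simp: is_power_branch_def)
  show "g 0 = 1" using assms by (simp add: is_power_branch_def)
  show "g holomorphic_on unit_disc"
    by (rule holomorphic_transform[of "\<lambda>z. exp (complex_of_real a * L z)"])
       (auto intro!: holomorphic_intros L simp: g)
  fix z assume z: "z \<in> unit_disc"
  show "g z \<noteq> 0" using g[OF z] by simp
  have DL: "(L has_field_derivative deriv L z) (at z)"
    using L z by (auto intro: holomorphic_derivI)
  have "((\<lambda>z. exp (L z)) has_field_derivative exp (L z) * deriv L z) (at z)"
    by (auto intro!: derivative_eq_intros DL)
  then have "(poly Q has_field_derivative exp (L z) * deriv L z) (at z)"
    by (rule has_field_derivative_transform_within_open[of _ _ _ unit_disc]) (use Q z in auto)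
  then have "poly (pderiv Q) z = poly Q z * deriv L z"
    using DERIV_unique poly_DERIV Q[OF z] by metis
  moreover have "poly Q z \<noteq> 0"
    using Q[OF z] by (metis exp_not_eq_zero)
  moreover have "((\<lambda>z. exp (complex_of_real a * L z)) has_field_derivative
      exp (complex_of_real a * L z) * (complex_of_real a * deriv L z)) (at z)"
    by (auto intro!: derivative_eq_intros DL)
  then have "(g has_field_derivative exp (complex_of_real a * L z) * (complex_of_real a * deriv L z)) (at z)"
    by (rule has_field_derivative_transform_within_open[of _ _ _ unit_disc]) (use g z in auto)
  then have "deriv g z = g z * (complex_of_real a * deriv L z)"
    using g[OF z] by (simp add: DERIV_imp_deriv)
  ultimately show "deriv g z / g z = complex_of_real a * (poly (pderiv Q) z / poly Q z)"
    using \<open>g z \<noteq> 0\<close> by simp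
qed

text \<open>By the chain rule \<open>deriv G z = deriv F (r z)\<close>, the factor \<open>r\<close>
  cancelling the division by \<open>r\<close>.\<close>

lemma starlike_quotient_dilation:
  assumes F: "F \<in> normalized_analytic" and r: "0 < r" "r < 1"
  defines "G \<equiv> \<lambda>z. F (complex_of_real r * z) / complex_of_real r"
  shows "G \<in> normalized_analytic"
    and "\<And>z. z \<in> unit_disc \<Longrightarrow> starlike_quotient G z = starlike_quotient F (complex_of_real r * z)"
proof -
  have F': "F holomorphic_on unit_disc" "F 0 = 0" "deriv F 0 = 1"
    using F by (auto simp: normalized_analytic_def)
  have D: "(G has_field_derivative deriv F (of_real r * z)) (at z)" if "z \<in> unit_disc" for z
  proof -
    have "norm (of_real r * z) < 1"
      using that r mult_strict_mono[of r 1 "norm z" 1] by (simp add: norm_mult)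
    then have "(F has_field_derivative deriv F (of_real r * z)) (at (of_real r * z))"
      by (intro holomorphic_derivI[OF F'(1)]) auto
    then have "((\<lambda>z. F (of_real r * z)) has_field_derivative deriv F (of_real r * z) * of_real r) (at z)"
      by (rule DERIV_chain2) (auto intro!: derivative_eq_intros)
    then show ?thesis
      unfolding G_def using r DERIV_cdivide[of _ "deriv F (of_real r * z) * of_real r" z UNIV "of_real r"]
      by simp
  qed
  have "G holomorphic_on unit_disc"
    unfolding holomorphic_on_open[OF open_ball] using D by blast
  then show "G \<in> normalized_analytic"
    using DERIV_imp_deriv[OF D[of 0]] F' by (simp add: normalized_analytic_def G_def)
  fix z assume "z \<in> unit_disc"
  then show "starlike_quotient G z = starlike_quotient F (of_real r * z)"
    using DERIV_imp_deriv[OF D[of z]] r by (simp add: starlike_quotient_def G_def)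
qed

lemma Re_of_real_times: "Re (complex_of_real a * z) = a * Re z"
  by simp

section \<open>The lower bound for the whole family\<close>

lemma starlike_poly_familyD:
  assumes F: "F \<in> starlike_poly_family \<alpha> \<beta> n" and "\<alpha> < 1" "\<beta> > 0" "n \<ge> 1"
  shows "F \<in> normalized_analytic"
    and "\<And>z. z \<in> unit_disc \<Longrightarrow> z \<noteq> 0 \<Longrightarrow> F z \<noteq> 0"
    and "\<And>z. z \<in> unit_disc \<Longrightarrow> Re (starlike_quotient F z) \<ge>
      \<alpha> + (1 - \<alpha>) * ((1 - norm z) / (1 + norm z)) - \<beta> * (norm z / (1 - norm z))"
proof -
  obtain f and Q :: "complex poly" and g where f: "f \<in> starlike_of_order \<alpha>"
    and Q: "degree Q = n" "\<And>z. poly Q z = 0 \<Longrightarrow> z \<notin> unit_disc"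
    and pb: "is_power_branch (poly Q) (\<beta> / real n) g"
    and Fz: "\<And>z. z \<in> unit_disc \<Longrightarrow> F z = f z * g z"
    using F by (auto simp: starlike_poly_family_def)
  note g = is_power_branch_log_deriv[OF pb]
  have f': "f \<in> normalized_analytic" "\<And>z. z \<in> unit_disc \<Longrightarrow> z \<noteq> 0 \<Longrightarrow> f z \<noteq> 0"
    using f by (auto simp: starlike_of_order_def)
  show "F \<in> normalized_analytic"
    by (rule normalized_analytic_mult[OF f'(1) g(1,2) Fz])
  show "F z \<noteq> 0" if "z \<in> unit_disc" "z \<noteq> 0" for z
    using that f' g Fz by simp
  fix z assume z: "z \<in> unit_disc"
  have "starlike_quotient F z = starlike_quotient f z + z * deriv g z / g z"
    using f' g z by (intro starlike_quotient_mult Fz) (auto simp: normalized_analytic_def)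
  also have "z * deriv g z / g z = of_real (\<beta> / real n) * (z * poly (pderiv Q) z / poly Q z)"
    using g(4)[OF z] by (metis mult.left_commute times_divide_eq_right)
  finally have "Re (starlike_quotient F z) =
      Re (starlike_quotient f z) + \<beta> / real n * Re (z * poly (pderiv Q) z / poly Q z)"
    by (simp only: plus_complex.simps Re_of_real_times)
  \<comment> \<open>The \<open>n\<close> zeros of \<open>Q\<close> are balanced by the exponent
    \<beta>/n, which makes the bound independent of \<open>n\<close>.\<close>
  moreover have "\<beta> / real n * Re (z * poly (pderiv Q) z / poly Q z) \<ge>
      \<beta> / real n * - (real n * (norm z / (1 - norm z)))"
    using poly_log_deriv_Re_ge[of Q z] Q z \<open>\<beta> > 0\<close> by (intro mult_left_mono) (force simp: not_less)+
  then have "\<beta> / real n * Re (z * poly (pderiv Q) z / poly Q z) \<ge> - (\<beta> * (norm z / (1 - norm z)))"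
    using \<open>n \<ge> 1\<close> by simp
  ultimately show "Re (starlike_quotient F z) \<ge>
      \<alpha> + (1 - \<alpha>) * ((1 - norm z) / (1 + norm z)) - \<beta> * (norm z / (1 - norm z))"
    using starlike_of_order_Re_ge[OF f \<open>\<alpha> < 1\<close> z] by linarith
qed

section \<open>The extremal function\<close>

lemma Re_one_plus_pos: "Re (1 + z) > 0" if "norm z < 1" for z :: complex
  using abs_Re_le_cmod[of z] that by simp

text \<open>On the disc \<open>1 + z\<close> stays in the right half-plane, away from the branch
  cut.\<close>

lemma Ln_one_plus:
  shows "(\<lambda>z. Ln (1 + z)) holomorphic_on unit_disc"
    and "z \<in> unit_disc \<Longrightarrow> ((\<lambda>z. Ln (1 + z)) has_field_derivative 1 / (1 + z)) (at z)"
proof -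
  have *: "1 + z \<notin> \<real>\<^sub>\<le>\<^sub>0" if "z \<in> unit_disc" for z :: complex
    using Re_one_plus_pos[of z] that by (auto simp: complex_nonpos_Reals_iff)
  then show "(\<lambda>z. Ln (1 + z)) holomorphic_on unit_disc"
    by (intro holomorphic_intros) auto
  show "((\<lambda>z. Ln (1 + z)) has_field_derivative 1 / (1 + z)) (at z)" if "z \<in> unit_disc"
    using *[OF that] by (auto intro!: derivative_eq_intros simp: field_simps)
qed

text \<open>The order is \<alpha> because \<open>z / (1 + z)\<close> maps the disc into the
  half-plane of real part below 1/2, and
  \<open>1 - (2 - 2 * \<alpha>) / 2 = \<alpha>\<close>.\<close>

lemma starlike_extremal:
  fixes \<alpha> :: real
  assumes "\<alpha> < 1"
  defines "f \<equiv> \<lambda>z. z * exp (- of_real (2 - 2 * \<alpha>) * Ln (1 + z))"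
  shows "f \<in> starlike_of_order \<alpha>"
    and "\<And>z. z \<in> unit_disc \<Longrightarrow> starlike_quotient f z = 1 - of_real (2 - 2 * \<alpha>) * (z / (1 + z))"
proof -
  define g where "g = (\<lambda>z. exp (- of_real (2 - 2 * \<alpha>) * Ln (1 + z)))"
  have hol: "g holomorphic_on unit_disc"
    unfolding g_def by (intro holomorphic_intros Ln_one_plus(1))
  have id: "(\<lambda>z. z) \<in> normalized_analytic"
    by (simp add: normalized_analytic_def)
  have fg: "f z = z * g z" for z
    by (simp add: f_def g_def)
  have na: "f \<in> normalized_analytic"
    by (rule normalized_analytic_mult[OF id hol]) (auto simp: g_def f_def)
  have D: "deriv g z = g z * (- of_real (2 - 2 * \<alpha>) * (1 / (1 + z)))" if "z \<in> unit_disc" for z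
    unfolding g_def
    by (rule DERIV_imp_deriv) (rule derivative_eq_intros Ln_one_plus(2) that refl | simp)+
  show quot: "starlike_quotient f z = 1 - of_real (2 - 2 * \<alpha>) * (z / (1 + z))"
    if z: "z \<in> unit_disc" for z
  proof -
    have "starlike_quotient f z = starlike_quotient (\<lambda>z. z) z + z * deriv g z / g z"
      using z by (intro starlike_quotient_mult hol fg) (auto simp: g_def)
    also have "starlike_quotient (\<lambda>z. z) z = 1"
      by (simp add: starlike_quotient_def)
    also have "z * deriv g z / g z = - of_real (2 - 2 * \<alpha>) * (z / (1 + z))"
      unfolding D[OF z] by (simp add: g_def)
    finally show ?thesis by (simp only: minus_mult_left[symmetric] uminus_add_conv_diff add_uminus_conv_diff)
  qed
  have "Re (starlike_quotient f z) > \<alpha>" if z: "z \<in> unit_disc" for z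
  proof -
    have nz: "(Re (1 + z))\<^sup>2 + (Im (1 + z))\<^sup>2 > 0"
      using Re_one_plus_pos[of z] z by (simp add: sum_power2_gt_zero_iff)
    have "(norm z)\<^sup>2 < 1"
      using z by (simp add: power_less_one_iff)
    then have "(Re z)\<^sup>2 + (Im z)\<^sup>2 < 1"
      by (simp add: cmod_power2)
    \<comment> \<open>After clearing denominators this is exactly \<open>norm z < 1\<close>
      squared.\<close>
    then have "Re (z / (1 + z)) < 1 / 2"
      using nz by (simp add: Re_divide divide_less_eq) (simp add: power2_eq_square algebra_simps)
    then have "(2 - 2 * \<alpha>) * Re (z / (1 + z)) < (2 - 2 * \<alpha>) * (1 / 2)"
      using \<open>\<alpha> < 1\<close> by (intro mult_strict_left_mono) auto
    moreover have "Re (starlike_quotient f z) = 1 - (2 - 2 * \<alpha>) * Re (z / (1 + z))"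
      unfolding quot[OF z] by (simp only: minus_complex.simps Re_of_real_times one_complex.simps)
    ultimately show ?thesis by simp
  qed
  then show "f \<in> starlike_of_order \<alpha>"
    using na by (auto simp: starlike_of_order_def fg g_def)
qed

text \<open>Equality in both estimates occurs simultaneously on the positive radius: there
  \<open>f\<close> attains the Schwarz bound, and the \<open>n\<close>-fold zero of \<open>Q\<close>
  at 1 is as close to \<open>r\<close> as a zero can be.\<close>

lemma starlike_poly_family_extremal:
  assumes "\<alpha> < 1" "n \<ge> 1"
  obtains F where "F \<in> starlike_poly_family \<alpha> \<beta> n"
    and "\<And>r. 0 \<le> r \<Longrightarrow> r < 1 \<Longrightarrow> starlike_quotient F (of_real r) =
      of_real (\<alpha> + (1 - \<alpha>) * ((1 - r) / (1 + r)) - \<beta> * (r / (1 - r)))"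
proof -
  define f where "f = (\<lambda>z. z * exp (- of_real (2 - 2 * \<alpha>) * Ln (1 + z)))"
  \<comment> \<open>A logarithm of \<open>(1 - z)^n\<close>. Its imaginary part may leave the
    principal strip, so it need not equal \<open>Ln\<close> of the polynomial.\<close>
  define L where "L = (\<lambda>z. of_nat n * Ln (1 + - z))"
  define Q :: "complex poly" where "Q = [:1, -1:] ^ n"
  define g where "g = (\<lambda>z. exp (complex_of_real (\<beta> / real n) * L z))"
  define F where "F = (\<lambda>z. f z * g z)"
  note f = starlike_extremal[OF \<open>\<alpha> < 1\<close>, folded f_def]
  have "(\<lambda>z. Ln (1 + - z)) holomorphic_on unit_disc"
    by (rule holomorphic_on_compose_gen[of uminus unit_disc "\<lambda>z. Ln (1 + z)" unit_disc,
          unfolded o_def]) (auto intro!: holomorphic_on_minus holomorphic_on_ident Ln_one_plus(1))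
  then have L: "L holomorphic_on unit_disc"
    unfolding L_def by (intro holomorphic_on_mult holomorphic_on_const)
  have expL: "exp (L z) = poly Q z" if "z \<in> unit_disc" for z
  proof -
    have "1 + - z \<noteq> 0" using that by auto
    then show ?thesis by (simp add: L_def Q_def exp_of_nat_mult)
  qed
  have pb: "is_power_branch (poly Q) (\<beta> / real n) g"
    unfolding is_power_branch_def
    using expL by (intro conjI exI[of _ L] L) (auto simp: g_def, simp add: L_def)
  note g = is_power_branch_log_deriv[OF pb]
  have "degree Q = n" "poly Q 0 = 1"
    by (simp_all add: Q_def degree_power_eq)
  moreover have Q0: "z \<notin> unit_disc" if "poly Q z = 0" for z
    using that expL by (metis exp_not_eq_zero)
  ultimately have "F \<in> starlike_poly_family \<alpha> \<beta> n"
    unfolding starlike_poly_family_def F_def using f(1) pb by blast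
  moreover have "starlike_quotient F (of_real r) =
      of_real (\<alpha> + (1 - \<alpha>) * ((1 - r) / (1 + r)) - \<beta> * (r / (1 - r)))"
    if r: "0 \<le> r" "r < 1" for r
  proof -
    have z: "of_real r \<in> unit_disc" using r by simp
    have nz: "1 - r \<noteq> 0" "1 + r \<noteq> 0" using r by auto
    then have nz': "1 - complex_of_real r \<noteq> 0" "1 + complex_of_real r \<noteq> 0"
      by (metis of_real_1 of_real_add of_real_diff of_real_eq_0_iff)+
    have "starlike_quotient F (of_real r) =
        starlike_quotient f (of_real r) + of_real r * deriv g (of_real r) / g (of_real r)"
      using f(1) z g by (intro starlike_quotient_mult)
        (auto simp: F_def starlike_of_order_def normalized_analytic_def)
    also have "starlike_quotient f (of_real r) = of_real (1 - (2 - 2 * \<alpha>) * (r / (1 + r)))"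
      using f(2)[OF z] by simp
    also have "of_real r * deriv g (of_real r) / g (of_real r) = of_real r *
        (of_real (\<beta> / real n) * (poly (pderiv Q) (of_real r) / poly Q (of_real r)))"
      by (simp only: g(4)[OF z] times_divide_eq_right[symmetric])
    also have "poly (pderiv Q) (of_real r) / poly Q (of_real r) = - of_nat n / (1 - complex_of_real r)"
    proof -
      obtain m where m: "n = Suc m" using \<open>n \<ge> 1\<close> by (cases n) auto
      show ?thesis
        using nz' unfolding Q_def m pderiv_power_Suc
        by (simp add: pderiv_pCons field_simps)
    qed
    also have "of_real r * (of_real (\<beta> / real n) * (- of_nat n / (1 - complex_of_real r))) =
        of_real (- \<beta> * (r / (1 - r)))"
      using \<open>n \<ge> 1\<close> by simp
    also have "complex_of_real (1 - (2 - 2 * \<alpha>) * (r / (1 + r))) + of_real (- \<beta> * (r / (1 - r))) =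
        of_real (1 - (2 - 2 * \<alpha>) * (r / (1 + r)) + - \<beta> * (r / (1 - r)))"
      by (rule of_real_add[symmetric])
    also have "1 - (2 - 2 * \<alpha>) * (r / (1 + r)) + - \<beta> * (r / (1 - r)) =
        \<alpha> + (1 - \<alpha>) * ((1 - r) / (1 + r)) - \<beta> * (r / (1 - r))"
    proof -
      have "1 - (2 - 2 * \<alpha>) * (r / (1 + r)) = \<alpha> + (1 - \<alpha>) * ((1 - r) / (1 + r))"
        using nz by (simp add: field_simps)
      then show ?thesis by simp
    qed
    finally show ?thesis .
  qed
  ultimately show ?thesis using that by blast
qed

section \<open>Sharpness and the radius of starlikeness\<close>

theorem theorem2p1:
  fixes \<alpha> \<mu> \<beta> :: real and n :: nat
  assumes "0 \<le> \<alpha>" and "\<alpha> < 1"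
    and "0 \<le> \<mu>" and "\<mu> < 1"
    and "\<beta> > 0"
    and "n \<ge> 1"
  shows "is_radius_of_starlikeness \<mu> (starlike_poly_family \<alpha> \<beta> n)
           (2 * (1 - \<mu>) /
              (2 - 2 * \<alpha> + \<beta> +
               sqrt ((2 - 2 * \<alpha> + \<beta>)\<^sup>2 + 4 * (1 - \<mu>) * (2 * \<alpha> + \<beta> - 1 - \<mu>))))"
proof -
  define R where "R = 2 * (1 - \<mu>) / (2 - 2 * \<alpha> + \<beta> +
    sqrt ((2 - 2 * \<alpha> + \<beta>)\<^sup>2 + 4 * (1 - \<mu>) * (2 * \<alpha> + \<beta> - 1 - \<mu>)))"
  define B where "B = (\<lambda>r. \<alpha> + (1 - \<alpha>) * ((1 - r) / (1 + r)) - \<beta> * (r / (1 - r)))"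
  \<comment> \<open>For these coefficients the condition \<open>a < b + c\<close> of the quadratic
    lemma amounts to \<open>\<beta> > 0\<close>.\<close>
  have R: "0 < R" "R < 1"
    "(1 - \<mu>) - (2 - 2 * \<alpha> + \<beta>) * R - (2 * \<alpha> + \<beta> - 1 - \<mu>) * R\<^sup>2 = 0"
    "0 \<le> r \<Longrightarrow> r < R \<Longrightarrow> (1 - \<mu>) - (2 - 2 * \<alpha> + \<beta>) * r - (2 * \<alpha> + \<beta> - 1 - \<mu>) * r\<^sup>2 > 0" for r
    unfolding R_def by (rule quadratic_smallest_root; use assms in simp)+
  have B_R: "B R = \<mu>"
    using lower_bound_minus_order_eq[of R \<alpha> \<beta> \<mu>] R by (simp add: B_def)
  have B_gt: "B r > \<mu>" if "0 \<le> r" "r < R" for r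
  proof -
    have "B r - \<mu> > 0"
      unfolding B_def using that R(2) R(4)[OF that] by (subst lower_bound_minus_order_eq) auto
    then show ?thesis by simp
  qed
  have "R \<in> starlike_radii \<mu> (starlike_poly_family \<alpha> \<beta> n)"
    unfolding starlike_radii_def
  proof (intro CollectI conjI ballI allI impI R(1,2))
    fix F r assume F: "F \<in> starlike_poly_family \<alpha> \<beta> n" and r: "0 < r \<and> r < R"
    note F' = starlike_poly_familyD[OF F \<open>\<alpha> < 1\<close> \<open>\<beta> > 0\<close> \<open>n \<ge> 1\<close>]
    have r1: "0 < r" "r < 1" using r R by auto
    note D = starlike_quotient_dilation[OF F'(1) r1]
    have small: "norm (of_real r * z) < R" "of_real r * z \<in> unit_disc" if "z \<in> unit_disc" for z :: complex
    proof -
      have "norm (of_real r * z) \<le> r"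
        using that r1 by (simp add: norm_mult mult_left_le)
      then show "norm (of_real r * z) < R" "of_real r * z \<in> unit_disc"
        using r r1 by auto
    qed
    have "Re (starlike_quotient F (of_real r * z)) > \<mu>" if "z \<in> unit_disc" for z
      using F'(3)[OF small(2)[OF that]] B_gt[OF norm_ge_zero small(1)[OF that]] by (simp add: B_def)
    moreover have "F (of_real r * z) \<noteq> 0" if "z \<in> unit_disc" "z \<noteq> 0" for z
      using F'(2)[OF small(2)[OF that(1)]] that r1 by simp
    ultimately show "(\<lambda>z. F (of_real r * z) / of_real r) \<in> starlike_of_order \<mu>"
      using D r1 by (simp add: starlike_of_order_def)
  qed
  moreover have "R' \<le> R" if R': "R' \<in> starlike_radii \<mu> (starlike_poly_family \<alpha> \<beta> n)" for R'
  proof (rule ccontr)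
    assume "\<not> R' \<le> R"
    \<comment> \<open>Dilating by some \<open>r > R\<close> brings the point \<open>R\<close> into
      the image of the open disc, so the strict inequality would have to hold there.\<close>
    then obtain r where r: "R < r" "r < R'" using dense[of R R'] by auto
    have r1: "0 < r" "r < 1" using r R R' by (auto simp: starlike_radii_def)
    obtain F where F: "F \<in> starlike_poly_family \<alpha> \<beta> n"
      and q: "\<And>r. 0 \<le> r \<Longrightarrow> r < 1 \<Longrightarrow> starlike_quotient F (of_real r) = of_real (B r)"
      using starlike_poly_family_extremal[OF \<open>\<alpha> < 1\<close> \<open>n \<ge> 1\<close>, of \<beta>] unfolding B_def by metis
    note F' = starlike_poly_familyD[OF F \<open>\<alpha> < 1\<close> \<open>\<beta> > 0\<close> \<open>n \<ge> 1\<close>]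
    \<comment> \<open>The point that the dilation sends to \<open>R\<close>, where the quotient of
      the extremal function equals \<open>B R = \<mu>\<close>.\<close>
    define z where "z = complex_of_real (R / r)"
    have z: "z \<in> unit_disc" "of_real r * z = of_real R"
    proof -
      have "norm z = R / r"
        unfolding z_def norm_of_real using r1 R by simp
      then show "z \<in> unit_disc"
        using r r1 by simp
      show "of_real r * z = of_real R"
        using r1 by (simp add: z_def)
    qed
    have "(\<lambda>z. F (of_real r * z) / of_real r) \<in> starlike_of_order \<mu>"
      using R' F r r1 by (simp add: starlike_radii_def)
    then have "Re (starlike_quotient (\<lambda>z. F (of_real r * z) / of_real r) z) > \<mu>"
      using z(1) by (auto simp: starlike_of_order_def)
    then show False
      using starlike_quotient_dilation(2)[OF F'(1) r1 z(1)] z(2) q[of R] R B_R by simp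
  qed
  ultimately show ?thesis
    unfolding is_radius_of_starlikeness_def R_def[symmetric] by blast
qed

end
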